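(* Let $(X,\mathcal{B})$ be a ball space such that $\mathcal{B}$ admits an ultra-diameter with values in a countable narrow poset. Then $(X,\mathcal{B})$ is chain intersection stable.
   Context: A ball space $(X,\mathcal{B})$ is a nonempty set $X$ with a nonempty collection $\mathcal{B}$ of nonempty subsets of $X$. A chain in $\mathcal{B}$ is a nonempty subset linearly ordered by inclusion. $(X,\mathcal{B})$ is chain intersection stable if for every nonempty family $\mathbb{F}$ of chains in $\mathcal{B}$ such that $\{\bigcap\mathcal{C}:\mathcal{C}\in\mathbb{F}\}$ is linearly ordered by inclusion, there is a chain $\mathcal{Y}\subseteq\mathcal{B}$ with $\bigcap\mathcal{Y}=\bigcap_{\mathcal{C}\in\mathbb{F}}\bigcap\mathcal{C}$. A poset is narrow if it has no infinite set of pairwise incomparable elements. An ultra-diameter on $\mathcal{B}$ is a function $\delta:\mathcal{B}\to\Gamma$, $\Gamma$ a poset, such that (D1) $B_0\subseteq B_1$ implies $\delta(B_0)\le\delta(B_1)$, and (D2) if $B_0,B_1\in\mathcal{B}$, $B_0\cap B_1\neq\emptyset$ and $\delta(B_0)\le\delta(B_1)$, then $B_0\subseteq B_1$. *)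

theory Defs
  imports Main "HOL-Library.Countable_Set" "HOL-Library.FuncSet"
begin

definition ball_space :: "'a set \<Rightarrow> 'a set set \<Rightarrow> bool" where
  "ball_space X \<B> \<longleftrightarrow> X \<noteq> {} \<and> \<B> \<noteq> {} \<and> (\<forall>B\<in>\<B>. B \<noteq> {} \<and> B \<subseteq> X)"

definition chain_in :: "'a set set \<Rightarrow> 'a set set \<Rightarrow> bool" where
  "chain_in \<B> \<C> \<longleftrightarrow> \<C> \<noteq> {} \<and> \<C> \<subseteq> \<B> \<and> chain\<^sub>\<subseteq> \<C>"

text \<open>The set \<open>X\<close> plays no role below: chains and the family \<open>\<F>\<close> are nonempty, so every
  intersection is one of a nonempty collection of balls.\<close>

definition chain_intersection_stable :: "'a set set \<Rightarrow> bool" where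
  "chain_intersection_stable \<B> \<longleftrightarrow>
    (\<forall>\<F>. \<F> \<noteq> {} \<and> (\<forall>\<C>\<in>\<F>. chain_in \<B> \<C>) \<and> chain\<^sub>\<subseteq> {\<Inter>\<C> | \<C>. \<C> \<in> \<F>} \<longrightarrow>
      (\<exists>\<Y>. chain_in \<B> \<Y> \<and> \<Inter>\<Y> = (\<Inter>\<C>\<in>\<F>. \<Inter>\<C>)))"

text \<open>A poset is a carrier \<open>\<Gamma>\<close> with a relation \<open>r\<close> such that \<open>partial_order_on \<Gamma> r\<close>;
  \<open>(a, b) \<in> r\<close> means \<open>a \<le> b\<close>.\<close>

definition narrow :: "'g set \<Rightarrow> ('g \<times> 'g) set \<Rightarrow> bool" where
  "narrow \<Gamma> r \<longleftrightarrow>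
    \<not> (\<exists>A\<subseteq>\<Gamma>. infinite A \<and> (\<forall>a\<in>A. \<forall>b\<in>A. a \<noteq> b \<longrightarrow> (a, b) \<notin> r \<and> (b, a) \<notin> r))"

definition ultra_diameter ::
  "'a set set \<Rightarrow> 'g set \<Rightarrow> ('g \<times> 'g) set \<Rightarrow> ('a set \<Rightarrow> 'g) \<Rightarrow> bool" where
  "ultra_diameter \<B> \<Gamma> r \<delta> \<longleftrightarrow>
    partial_order_on \<Gamma> r \<and> \<delta> \<in> \<B> \<rightarrow> \<Gamma> \<and>
    (\<forall>B0\<in>\<B>. \<forall>B1\<in>\<B>. B0 \<subseteq> B1 \<longrightarrow> (\<delta> B0, \<delta> B1) \<in> r) \<and>
    (\<forall>B0\<in>\<B>. \<forall>B1\<in>\<B>. B0 \<inter> B1 \<noteq> {} \<and> (\<delta> B0, \<delta> B1) \<in> r \<longrightarrow> B0 \<subseteq> B1)"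

end

theory Submission
  imports Defs
begin

text \<open>
  If some chain of the family has empty intersection, it serves as \<open>\<Y>\<close>. Otherwise linearity of the
  intersections makes any two balls occurring in the family meet, so \<open>\<delta>\<close> embeds the set \<open>S\<close> of
  these balls, ordered by inclusion, into \<open>\<Gamma>\<close>; hence \<open>S\<close> is countable and narrow. A narrow poset
  is a finite union of filters (Erdos--Tarski). By finiteness some filter \<open>F\<close> satisfies
  \<open>\<Inter>F \<subseteq> \<Inter>\<C>\<close> for all \<open>\<C>\<close> in the family, and a coinitial chain of the countable filter \<open>F\<close> is
  the required \<open>\<Y>\<close>.
\<close>

definition compatible :: "'b::order set \<Rightarrow> 'b \<Rightarrow> 'b \<Rightarrow> bool" where
  "compatible S x y \<longleftrightarrow> (\<exists>z\<in>S. z \<le> x \<and> z \<le> y)"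

text \<open>In forcing terms an \<open>x\<close> in \<open>S\<close> with this property is an atom:
  no two incompatible elements of \<open>S\<close> lie below it.\<close>

definition directed_below :: "'b::order set \<Rightarrow> 'b \<Rightarrow> bool" where
  "directed_below S x \<longleftrightarrow> (\<forall>u\<in>S. \<forall>v\<in>S. u \<le> x \<and> v \<le> x \<longrightarrow> compatible S u v)"

definition no_infinite_antichain :: "'b::order set \<Rightarrow> bool" where
  "no_infinite_antichain S \<longleftrightarrow>
    (\<forall>A\<subseteq>S. (\<forall>a\<in>A. \<forall>b\<in>A. a \<le> b \<longrightarrow> a = b) \<longrightarrow> finite A)"

lemma compatible_mono:
  "compatible S x y \<Longrightarrow> x \<le> x' \<Longrightarrow> y \<le> y' \<Longrightarrow> compatible S x' y'"
  unfolding compatible_def by (meson order_trans)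

lemma compatible_if_le: "x \<in> S \<Longrightarrow> x \<le> y \<Longrightarrow> compatible S x y"
  unfolding compatible_def by blast

lemma compatible_sym: "compatible S x y \<Longrightarrow> compatible S y x"
  unfolding compatible_def by blast

text \<open>Otherwise every element below \<open>x\<close> splits into two incompatible ones.
  Setting one half aside and splitting the other again, forever, yields infinitely many pairwise
  incompatible elements, which form an antichain.\<close>

lemma ex_directed_below:
  fixes S :: "'b::order set"
  assumes nar: "no_infinite_antichain S" and x: "x \<in> S"
  shows "\<exists>g\<in>S. g \<le> x \<and> directed_below S g"
proof (rule ccontr)
  assume none: "\<not> ?thesis"
  have split: "\<exists>u v. u \<in> S \<and> v \<in> S \<and> u \<le> y \<and> v \<le> y \<and> \<not> compatible S u v"
    if "y \<in> S" "y \<le> x" for y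
    using none that unfolding directed_below_def by blast
  \<comment> \<open>In each pair the first component is the half set aside and the second is the
    half to be split next; \<open>?Q\<close> puts both halves of the next pair below the
    latter.\<close>
  let ?P = "\<lambda>(n::nat) p. fst p \<in> S \<and> snd p \<in> S \<and> snd p \<le> x \<and> \<not> compatible S (fst p) (snd p)"
  let ?Q = "\<lambda>(n::nat) p q. fst q \<le> snd p \<and> snd q \<le> snd p"
  have "\<exists>f. \<forall>n. ?P n (f n) \<and> ?Q n (f n) (f (Suc n))"
  proof (rule dependent_nat_choice)
    show "\<exists>p. ?P 0 p" using split[OF x] by auto
  next
    fix p and n :: nat assume "?P n p"
    then show "\<exists>q. ?P (Suc n) q \<and> ?Q n p q"
      using split[of "snd p"] by (auto intro: order_trans)
  qed
  then obtain f where P: "\<And>n. ?P n (f n)" and Q: "\<And>n. ?Q n (f n) (f (Suc n))"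
    by blast
  define u where "u n = fst (f n)" for n
  have dec: "snd (f n) \<le> snd (f m)" if "m \<le> n" for m n
    by (rule lift_Suc_antimono_le[OF _ that]) (use Q in auto)
  have u_le: "u n \<le> snd (f m)" if mn: "m < n" for m n
  proof -
    obtain k where k: "n = Suc k" "m \<le> k" using mn by (cases n) auto
    then show ?thesis unfolding u_def using Q[of k] dec[of m k] by (auto intro: order_trans)
  qed
  have inc: "\<not> compatible S (u m) (u n)" if "m \<noteq> n" for m n
  proof -
    \<comment> \<open>All later \<open>u j\<close> lie below the second half of pair
      \<open>i\<close>, which is incompatible with \<open>u i\<close>.\<close>
    have *: "\<not> compatible S (u i) (u j)" if "i < j" for i j
      using P[of i] u_le[OF that] compatible_mono[of S "u i" "u j" "u i" "snd (f i)"]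
      unfolding u_def by auto
    show ?thesis using *[of m n] *[of n m] that compatible_sym by (metis nat_neq_iff)
  qed
  have uS: "u n \<in> S" for n using P unfolding u_def by auto
  have anti: "m = n" if "u m \<le> u n" for m n
    using inc[of m n] compatible_if_le[OF uS that] by blast
  have "inj u" by (rule injI) (simp add: anti)
  then have "infinite (range u)" by (simp add: finite_image_iff)
  moreover have "range u \<subseteq> S" "\<forall>a\<in>range u. \<forall>b\<in>range u. a \<le> b \<longrightarrow> a = b"
    using uS anti by auto
  ultimately show False using nar unfolding no_infinite_antichain_def by blast
qed

text \<open>Take for \<open>G\<close> a maximal set of pairwise incompatible atoms. It is an
  antichain, hence finite. An \<open>x\<close> incompatible with all of \<open>G\<close> would have
  an atom below it, and that atom could be added to \<open>G\<close>.\<close>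

lemma finite_directed_cover:
  fixes S :: "'b::order set"
  assumes nar: "no_infinite_antichain S"
  shows "\<exists>G. finite G \<and> G \<subseteq> S \<and> (\<forall>g\<in>G. directed_below S g) \<and> (\<forall>x\<in>S. \<exists>g\<in>G. compatible S g x)"
proof -
  define \<A> where "\<A> = {A. A \<subseteq> S \<and> (\<forall>g\<in>A. directed_below S g) \<and>
    (\<forall>a\<in>A. \<forall>b\<in>A. compatible S a b \<longrightarrow> a = b)}"
  have "\<exists>M\<in>\<A>. \<forall>Y\<in>\<A>. M \<subseteq> Y \<longrightarrow> Y = M"
  proof (rule subset_Zorn')
    fix C assume C: "subset.chain \<A> C"
    have CA: "C \<subseteq> \<A>" using C by (simp add: subset_chain_def)
    have "a = b" if ab: "a \<in> \<Union>C" "b \<in> \<Union>C" "compatible S a b" for a b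
    proof -
      obtain A B where AB: "A \<in> C" "B \<in> C" "a \<in> A" "b \<in> B" using ab by blast
      then have "A \<subseteq> B \<or> B \<subseteq> A" using C by (auto simp: subset_chain_def)
      then obtain D where "D \<in> C" "a \<in> D" "b \<in> D" using AB by blast
      then show ?thesis using CA ab(3) unfolding \<A>_def by blast
    qed
    then show "\<Union>C \<in> \<A>" using CA unfolding \<A>_def by blast
  qed
  then obtain M where M: "M \<in> \<A>" and max: "\<And>Y. Y \<in> \<A> \<Longrightarrow> M \<subseteq> Y \<Longrightarrow> Y = M" by blast
  have "\<forall>a\<in>M. \<forall>b\<in>M. a \<le> b \<longrightarrow> a = b"
    using M compatible_if_le unfolding \<A>_def by blast
  moreover have MS: "M \<subseteq> S" "\<forall>g\<in>M. directed_below S g" using M unfolding \<A>_def by blast+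
  ultimately have fin: "finite M" using nar unfolding no_infinite_antichain_def by blast
  have "\<exists>g\<in>M. compatible S g x" if x: "x \<in> S" for x
  proof (rule ccontr)
    assume none: "\<not> ?thesis"
    obtain g where g: "g \<in> S" "g \<le> x" "directed_below S g"
      using ex_directed_below[OF nar x] by blast
    have no: "\<not> compatible S h g" if "h \<in> M" for h
      using none that compatible_mono[OF _ order_refl g(2)] by blast
    then have "insert g M \<in> \<A>" using M g compatible_sym unfolding \<A>_def by blast
    then have "g \<in> M" using max[of "insert g M"] by blast
    then show False using no compatible_if_le[OF g(1) order_refl] by blast
  qed
  then show ?thesis using MS fin by blast
qed

text \<open>Descend along an enumeration of \<open>F\<close>: the next term is a common lower bound
  in \<open>F\<close> of the current term and the next enumerated element.\<close>

lemma countable_directed_coinitial_seq: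
  fixes F :: "'b::order set"
  assumes "countable F" "F \<noteq> {}" and dir: "\<And>x y. x \<in> F \<Longrightarrow> y \<in> F \<Longrightarrow> compatible F x y"
  shows "\<exists>f::nat \<Rightarrow> 'b. range f \<subseteq> F \<and> antimono f \<and> (\<forall>x\<in>F. \<exists>n. f n \<le> x)"
proof -
  \<comment> \<open>This enumeration repeats elements if \<open>F\<close> is finite, so that case
    needs no separate treatment.\<close>
  define e where "e = from_nat_into F"
  have eF: "range e = F" unfolding e_def using assms by (simp add: range_from_nat_into)
  have "\<exists>f. \<forall>n. (f n \<in> F \<and> f n \<le> e n) \<and> f (Suc n) \<le> f n"
  proof (rule dependent_nat_choice)
    show "\<exists>x. x \<in> F \<and> x \<le> e 0" using eF by blast
  next
    fix x n assume "x \<in> F \<and> x \<le> e n"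
    then show "\<exists>y. (y \<in> F \<and> y \<le> e (Suc n)) \<and> y \<le> x"
      using dir[of x "e (Suc n)"] eF unfolding compatible_def by blast
  qed
  then obtain f where f: "\<And>n. f n \<in> F" "\<And>n. f n \<le> e n" "\<And>n. f (Suc n) \<le> f n" by blast
  have "antimono f" using f(3) by (simp add: antimono_iff_le_Suc)
  moreover have "\<exists>n. f n \<le> x" if x: "x \<in> F" for x
  proof -
    obtain n where "x = e n" using x eF by blast
    then show ?thesis using f(2) by blast
  qed
  ultimately show ?thesis using f(1) by blast
qed

text \<open>Serves to turn finitely many counterexamples, one for each filter, into a single one
  that works against all filters.\<close>

lemma finite_choice_from_chain_has_least:
  fixes h :: "'i \<Rightarrow> 'b::order"
  assumes "finite G" "G \<noteq> {}" and lin: "\<And>i j. i \<in> G \<Longrightarrow> j \<in> G \<Longrightarrow> h i \<le> h j \<or> h j \<le> h i"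
  obtains i where "i \<in> G" "\<And>j. j \<in> G \<Longrightarrow> h i \<le> h j"
proof -
  obtain m where m: "m \<in> h ` G" "\<And>b. b \<in> h ` G \<Longrightarrow> b \<le> m \<Longrightarrow> m = b"
    using finite_has_minimal[of "h ` G"] assms by blast
  then obtain i where i: "i \<in> G" "m = h i" by blast
  then have "h i \<le> h j" if "j \<in> G" for j using m(2)[of "h j"] lin[OF i(1) that] that by auto
  then show thesis using that i by blast
qed

lemma chain_in_narrow_countable_family:
  fixes \<F> :: "'a set set set"
  assumes ne: "\<F> \<noteq> {}" and ch: "\<And>\<C>. \<C> \<in> \<F> \<Longrightarrow> chain_in \<B> \<C>"
    and lin: "chain\<^sub>\<subseteq> {\<Inter>\<C> | \<C>. \<C> \<in> \<F>}"
    and cnt: "countable (\<Union>\<F>)" and nar: "no_infinite_antichain (\<Union>\<F>)"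
  shows "\<exists>\<Y>. chain_in \<B> \<Y> \<and> \<Inter>\<Y> = (\<Inter>\<C>\<in>\<F>. \<Inter>\<C>)"
proof -
  define S where "S = \<Union>\<F>"
  have SB: "S \<subseteq> \<B>" using ch unfolding S_def chain_in_def by blast
  obtain G where fin: "finite G" and GS: "G \<subseteq> S" and dir: "\<And>g. g \<in> G \<Longrightarrow> directed_below S g"
    and cov: "\<And>x. x \<in> S \<Longrightarrow> \<exists>g\<in>G. compatible S g x"
    using finite_directed_cover[OF nar] unfolding S_def by blast
  have "S \<noteq> {}" using ne ch unfolding S_def chain_in_def by blast
  then have Gne: "G \<noteq> {}" using cov by blast
  \<comment> \<open>The filter of the atom \<open>g\<close>. By \<open>cov\<close>, these finitely
    many filters cover \<open>S\<close>.\<close>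
  define F where "F g = {x \<in> S. compatible S g x}" for g
  have sub: "\<exists>g\<in>G. \<C> \<subseteq> F g" if C: "\<C> \<in> \<F>" for \<C>
  proof (rule ccontr)
    \<comment> \<open>Each filter \<open>F g\<close> then misses some \<open>h g\<close> in
      \<open>\<C>\<close>. The least of these, \<open>h i\<close>, lies in some filter
      \<open>F g\<close>, and so does \<open>h g\<close> above it, a contradiction.\<close>
    assume "\<not> ?thesis"
    then have "\<forall>g\<in>G. \<exists>c. c \<in> \<C> \<and> c \<notin> F g" by blast
    then obtain h where h: "\<And>g. g \<in> G \<Longrightarrow> h g \<in> \<C> \<and> h g \<notin> F g" by metis
    have "chain\<^sub>\<subseteq> \<C>" using ch[OF C] unfolding chain_in_def by blast
    then have "h i \<subseteq> h j \<or> h j \<subseteq> h i" if "i \<in> G" "j \<in> G" for i j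
      using h that unfolding chain_subset_def by blast
    then obtain i where i: "i \<in> G" "\<And>j. j \<in> G \<Longrightarrow> h i \<subseteq> h j"
      using finite_choice_from_chain_has_least[OF fin Gne, of h] by blast
    have CS: "\<C> \<subseteq> S" using C unfolding S_def by blast
    then obtain g where g: "g \<in> G" "compatible S g (h i)" using cov h i(1) by blast
    then have "compatible S g (h g)" using compatible_mono[OF _ order_refl i(2)] by blast
    then show False using h[OF g(1)] CS unfolding F_def by blast
  qed
  have "\<exists>g\<in>G. \<forall>\<C>\<in>\<F>. \<Inter>(F g) \<subseteq> \<Inter>\<C>"
  proof (rule ccontr)
    \<comment> \<open>Now each filter \<open>F g\<close> fails for some chain \<open>k g\<close>.
      The chain \<open>k i\<close> with the least intersection is contained in some
      \<open>F g\<close>, so \<open>\<Inter>(F g)\<close> lies in \<open>\<Inter>(k i)\<close> and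
      hence in \<open>\<Inter>(k g)\<close>.\<close>
    assume "\<not> ?thesis"
    then have "\<forall>g\<in>G. \<exists>\<C>. \<C> \<in> \<F> \<and> \<not> \<Inter>(F g) \<subseteq> \<Inter>\<C>" by blast
    then obtain k where k: "\<And>g. g \<in> G \<Longrightarrow> k g \<in> \<F> \<and> \<not> \<Inter>(F g) \<subseteq> \<Inter>(k g)" by metis
    have "\<Inter>(k i) \<subseteq> \<Inter>(k j) \<or> \<Inter>(k j) \<subseteq> \<Inter>(k i)" if "i \<in> G" "j \<in> G" for i j
      using lin k that unfolding chain_subset_def by blast
    then obtain i where i: "i \<in> G" "\<And>j. j \<in> G \<Longrightarrow> \<Inter>(k i) \<subseteq> \<Inter>(k j)"
      using finite_choice_from_chain_has_least[OF fin Gne, of "\<lambda>g. \<Inter>(k g)"] by blast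
    obtain g where g: "g \<in> G" "k i \<subseteq> F g" using sub k i(1) by blast
    have "\<Inter>(F g) \<subseteq> \<Inter>(k i)" using g(2) by (rule Inter_anti_mono)
    then show False using i(2)[OF g(1)] k[OF g(1)] by (meson order_trans)
  qed
  then obtain g where g: "g \<in> G" and le: "\<And>\<C>. \<C> \<in> \<F> \<Longrightarrow> \<Inter>(F g) \<subseteq> \<Inter>\<C>" by blast
  have FS: "F g \<subseteq> S" unfolding F_def by blast
  have gF: "g \<in> F g" using g GS compatible_if_le unfolding F_def by blast
  have "compatible (F g) x y" if xyF: "x \<in> F g" "y \<in> F g" for x y
  proof -
    \<comment> \<open>Both elements are first pushed below \<open>g\<close>, where directedness
      applies; the resulting \<open>z\<close> is in the filter since it lies below
      \<open>g\<close>.\<close>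
    obtain x' y' where "x' \<in> S" "y' \<in> S" and xy: "x' \<le> g" "x' \<le> x" "y' \<le> g" "y' \<le> y"
      using xyF unfolding F_def compatible_def by blast
    then have "compatible S x' y'" using dir[OF g] unfolding directed_below_def by simp
    then obtain z where z: "z \<in> S" "z \<le> x'" "z \<le> y'" unfolding compatible_def by (elim bexE conjE)
    have "z \<le> g" "z \<le> x" "z \<le> y" using z xy by (meson order_trans)+
    moreover have "compatible S g z" by (rule compatible_sym) (intro compatible_if_le z(1) \<open>z \<le> g\<close>)
    then have "z \<in> F g" using z(1) unfolding F_def by simp
    ultimately show ?thesis unfolding compatible_def by (intro bexI[of _ z] conjI)
  qed
  moreover have "countable (F g)" using cnt FS unfolding S_def by (rule countable_subset[rotated])
  ultimately obtain f :: "nat \<Rightarrow> 'a set" where f: "range f \<subseteq> F g" "antimono f"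
      and f_le: "\<And>x. x \<in> F g \<Longrightarrow> \<exists>n. f n \<subseteq> x"
    using countable_directed_coinitial_seq[of "F g"] gF by blast
  have "f m \<subseteq> f n \<or> f n \<subseteq> f m" for m n using f(2) by (metis antimonoD nat_le_linear)
  then have "chain_in \<B> (range f)"
    using f(1) FS SB unfolding chain_in_def chain_subset_def by blast
  moreover have "\<Inter>(range f) = (\<Inter>\<C>\<in>\<F>. \<Inter>\<C>)"
  proof
    have "\<Inter>(range f) \<subseteq> \<Inter>(F g)" using f_le by blast
    then show "\<Inter>(range f) \<subseteq> (\<Inter>\<C>\<in>\<F>. \<Inter>\<C>)"
      by (intro INT_greatest) (rule order_trans[OF _ le])
    \<comment> \<open>For the converse inclusion it is enough that every \<open>f n\<close> is a
      ball of some chain in \<open>\<F>\<close>.\<close>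
    have "(\<Inter>\<C>\<in>\<F>. \<Inter>\<C>) \<subseteq> \<Inter>S" unfolding S_def by blast
    also have "\<Inter>S \<subseteq> \<Inter>(range f)" using f(1) FS by (intro Inter_anti_mono) (rule order_trans)
    finally show "(\<Inter>\<C>\<in>\<F>. \<Inter>\<C>) \<subseteq> \<Inter>(range f)" .
  qed
  ultimately show ?thesis by blast
qed

theorem theorem3p4:
  fixes X :: "'a set" and \<B> :: "'a set set"
    and \<Gamma> :: "'g set" and r :: "('g \<times> 'g) set"
  assumes "ball_space X \<B>"
    and "partial_order_on \<Gamma> r"
    and "countable \<Gamma>"
    and "narrow \<Gamma> r"
    and "\<exists>\<delta>. ultra_diameter \<B> \<Gamma> r \<delta>"
  shows "chain_intersection_stable \<B>"
  unfolding chain_intersection_stable_def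
proof (intro allI impI, elim conjE)
  fix \<F> :: "'a set set set"
  assume ne: "\<F> \<noteq> {}" and ch: "\<forall>\<C>\<in>\<F>. chain_in \<B> \<C>" and lin: "chain\<^sub>\<subseteq> {\<Inter>\<C> | \<C>. \<C> \<in> \<F>}"
  show "\<exists>\<Y>. chain_in \<B> \<Y> \<and> \<Inter>\<Y> = (\<Inter>\<C>\<in>\<F>. \<Inter>\<C>)"
  proof (cases "\<exists>\<C>\<in>\<F>. \<Inter>\<C> = {}")
    case True
    then obtain \<C> where "\<C> \<in> \<F>" "\<Inter>\<C> = {}" by blast
    then show ?thesis using ch by (intro exI[of _ \<C>]) auto
  next
    case False
    obtain \<delta> where \<delta>: "ultra_diameter \<B> \<Gamma> r \<delta>" using assms(5) by blast
    then have ran: "\<delta> \<in> \<B> \<rightarrow> \<Gamma>" unfolding ultra_diameter_def by blast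
    have D2: "\<And>A B. A \<in> \<B> \<Longrightarrow> B \<in> \<B> \<Longrightarrow> A \<inter> B \<noteq> {} \<Longrightarrow> (\<delta> A, \<delta> B) \<in> r \<Longrightarrow> A \<subseteq> B"
      using \<delta> unfolding ultra_diameter_def by simp
    have SB: "\<Union>\<F> \<subseteq> \<B>" using ch unfolding chain_in_def by blast
    \<comment> \<open>The smaller of the two nonempty intersections lies in both balls.\<close>
    have meet: "A \<inter> B \<noteq> {}" if AB: "A \<in> \<Union>\<F>" "B \<in> \<Union>\<F>" for A B
    proof -
      obtain \<C> \<D> where CD: "\<C> \<in> \<F>" "\<D> \<in> \<F>" "A \<in> \<C>" "B \<in> \<D>" using AB by blast
      then have "\<Inter>\<C> \<subseteq> \<Inter>\<D> \<or> \<Inter>\<D> \<subseteq> \<Inter>\<C>" using lin unfolding chain_subset_def by blast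
      moreover have "\<Inter>\<C> \<subseteq> A" "\<Inter>\<D> \<subseteq> B" using CD by blast+
      moreover have "\<Inter>\<C> \<noteq> {}" "\<Inter>\<D> \<noteq> {}" using False CD by blast+
      ultimately show ?thesis by blast
    qed
    \<comment> \<open>As the balls meet, (D2) applies: on \<open>\<Union>\<F>\<close> the map
      \<open>\<delta>\<close> reflects the order. Injectivity and the transfer of antichains to
      \<open>\<Gamma>\<close> both rest on this.\<close>
    have emb: "A \<subseteq> B" if "A \<in> \<Union>\<F>" "B \<in> \<Union>\<F>" "(\<delta> A, \<delta> B) \<in> r" for A B
      using D2[OF _ _ meet[OF that(1,2)] that(3)] that SB by blast
    have \<Gamma>: "\<delta> ` \<Union>\<F> \<subseteq> \<Gamma>" using ran SB by blast
    have refl: "(x, x) \<in> r" if "x \<in> \<Gamma>" for x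
      using assms(2) that unfolding partial_order_on_def preorder_on_def by (blast dest: refl_onD)
    have inj: "inj_on \<delta> (\<Union>\<F>)"
    proof (rule inj_onI)
      fix A B assume AB: "A \<in> \<Union>\<F>" "B \<in> \<Union>\<F>" "\<delta> A = \<delta> B"
      then have "(\<delta> A, \<delta> B) \<in> r" "(\<delta> B, \<delta> A) \<in> r" using refl[of "\<delta> B"] \<Gamma> by auto
      then show "A = B" using emb AB(1,2) by blast
    qed
    have "countable (\<Union>\<F>)"
      using countable_image_inj_on[OF countable_subset[OF \<Gamma> assms(3)] inj] .
    moreover have "no_infinite_antichain (\<Union>\<F>)"
      unfolding no_infinite_antichain_def
    proof (intro allI impI)
      fix A assume A: "A \<subseteq> \<Union>\<F>" and anti: "\<forall>a\<in>A. \<forall>b\<in>A. a \<subseteq> b \<longrightarrow> a = b"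
      have "a = b" if "a \<in> A" "b \<in> A" "(\<delta> a, \<delta> b) \<in> r" for a b
        using anti emb[of a b] that A by blast
      then have "\<forall>a\<in>\<delta> ` A. \<forall>b\<in>\<delta> ` A. a \<noteq> b \<longrightarrow> (a, b) \<notin> r \<and> (b, a) \<notin> r"
        by blast
      moreover have "\<delta> ` A \<subseteq> \<Gamma>" using A \<Gamma> by blast
      ultimately have "finite (\<delta> ` A)" using assms(4) unfolding narrow_def by blast
      then show "finite A" using inj_on_subset[OF inj A] finite_imageD by blast
    qed
    ultimately show ?thesis using chain_in_narrow_countable_family[OF ne _ lin] ch by blast
  qed
qed

end
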